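(* Let $f:\mathbb{R}^d\to\mathbb{R}$ be a differentiable convex function whose gradient is Lipschitz continuous with constant $L>0$. Let $x_0\in\mathbb{R}^d$ and define $$x_{k+1}=x_k-\alpha_k\nabla f(x_k),\qquad\forall k\ge 0,$$ where the stepsizes $\{\alpha_k\}_{k\in\mathbb{N}}\subseteq(0,+\infty)$ either satisfy $\alpha_k\le 1/L$ for all $k$, or are produced by backtracking line search. Then the sequence $\{x_k\}_{k\ge 0}$ is self-contracted.
   Context: $\mathbb{R}^d$ is the $d$-dimensional Euclidean space with inner product $\langle\cdot,\cdot\rangle$ and norm $\|\cdot\|$. A sequence $\{x_k\}$ in $\mathbb{R}^d$ is called self-contracted if for all indices $k_1\le k_2\le k_3$ one has $\|x_{k_3}-x_{k_2}\|\le\|x_{k_3}-x_{k_1}\|$. Backtracking line search: fix $\alpha>0$ and $0<q<1$, and write $T_\beta(x)=x-\beta\nabla f(x)$ for $\beta>0$. At each iteration $k\ge0$, set $\alpha_k=\alpha$; while $$f(T_{\alpha_k}(x_k))>f(x_k)+\langle\nabla f(x_k),T_{\alpha_k}(x_k)-x_k\rangle+\frac{1}{2\alpha_k}\|T_{\alpha_k}(x_k)-x_k\|^2,$$ replace $\alpha_k$ by $q\alpha_k$; the final value is the stepsize $\alpha_k$ (that is, $\alpha_k$ is the first element of $\alpha,\alpha q,\alpha q^2,\dots$ for which the displayed strict inequality fails). *)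

theory Defs
  imports "HOL-Analysis.Analysis"
begin

definition self_contracted :: "(nat \<Rightarrow> 'a::real_normed_vector) \<Rightarrow> bool" where
  "self_contracted x \<longleftrightarrow>
     (\<forall>k1 k2 k3. k1 \<le> k2 \<and> k2 \<le> k3 \<longrightarrow> norm (x k3 - x k2) \<le> norm (x k3 - x k1))"

definition gradient_step :: "('a::real_inner \<Rightarrow> 'a) \<Rightarrow> real \<Rightarrow> 'a \<Rightarrow> 'a" where
  "gradient_step g \<beta> x = x - \<beta> *\<^sub>R g x"

(* In the following two definitions, g stands for the gradient of f. *)

definition backtracking_test ::
    "('a::real_inner \<Rightarrow> real) \<Rightarrow> ('a \<Rightarrow> 'a) \<Rightarrow> 'a \<Rightarrow> real \<Rightarrow> bool" where
  "backtracking_test f g x \<beta> \<longleftrightarrow>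
     f (gradient_step g \<beta> x) >
       f x + g x \<bullet> (gradient_step g \<beta> x - x)
           + 1 / (2 * \<beta>) * (norm (gradient_step g \<beta> x - x))\<^sup>2"

(* The loop shrinks the stepsize as long as the test holds; its result \<beta> is therefore the first
   element of \<alpha>, \<alpha> * q, \<alpha> * q^2, ... at which the test fails. If the loop did not terminate,
   no \<beta> would satisfy the predicate. *)

definition backtracking_stepsize ::
    "('a::real_inner \<Rightarrow> real) \<Rightarrow> ('a \<Rightarrow> 'a) \<Rightarrow> real \<Rightarrow> real \<Rightarrow> 'a \<Rightarrow> real \<Rightarrow> bool" where
  "backtracking_stepsize f g \<alpha> q x \<beta> \<longleftrightarrow>
     (\<exists>i. \<beta> = \<alpha> * q ^ i \<and> \<not> backtracking_test f g x (\<alpha> * q ^ i)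
          \<and> (\<forall>j<i. backtracking_test f g x (\<alpha> * q ^ j)))"

end

theory Submission
  imports Defs
begin

text \<open>
  Every admissible stepsize decreases $f$ by at least $s \|g(x)\|^2 / 2$. As the values of $f$ decrease
  along the sequence, convexity gives, for $j < k$,
  $\langle g(x_j), x_k - x_j\rangle \le f(x_k) - f(x_j) \le f(x_{j+1}) - f(x_j) \le - s_j \|g(x_j)\|^2 / 2$.
  This is exactly the inequality $\|x_k - x_{j+1}\| \le \|x_k - x_j\|$ after expanding the square,
  and it chains over consecutive $j$.
\<close>

text \<open>Chain rule along a line. It reduces both the tangent inequality and the quadratic upper
  bound for \<open>f\<close> to calculus in one real variable.\<close>

lemma GDERIV_along_line:
  fixes f :: "'a::real_inner \<Rightarrow> real"
  assumes "GDERIV f (x + t *\<^sub>R h) :> D"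
  shows "((\<lambda>t. f (x + t *\<^sub>R h)) has_real_derivative D \<bullet> h) (at t)"
proof -
  have "((\<lambda>t. x + t *\<^sub>R h) has_derivative (\<lambda>r. r *\<^sub>R h)) (at t)"
    by (auto intro!: derivative_eq_intros)
  then have "((\<lambda>t. f (x + t *\<^sub>R h)) has_derivative (\<lambda>r. (r *\<^sub>R h) \<bullet> D)) (at t)"
    using assms unfolding gderiv_def by (rule has_derivative_compose)
  then show ?thesis
    by (simp add: has_field_derivative_def inner_commute mult_commute_abs)
qed

text \<open>The restriction of \<open>f\<close> to the line through \<open>x\<close> and
  \<open>y\<close> is convex in one variable, and its tangent at 0 is compared with its value at
  1.\<close>

lemma convex_on_GDERIV_above_tangent:
  fixes f :: "'a::real_inner \<Rightarrow> real"
  assumes "convex_on UNIV f" and "GDERIV f x :> D"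
  shows "f x + D \<bullet> (y - x) \<le> f y"
proof -
  have conv: "convex_on UNIV (\<lambda>t. f (x + t *\<^sub>R (y - x)))"
  proof (rule convex_onI)
    fix t a b :: real
    assume "0 < t" "t < 1"
    have "x + ((1 - t) *\<^sub>R a + t *\<^sub>R b) *\<^sub>R (y - x)
        = (1 - t) *\<^sub>R (x + a *\<^sub>R (y - x)) + t *\<^sub>R (x + b *\<^sub>R (y - x))"
      by (simp add: algebra_simps)
    then show "f (x + ((1 - t) *\<^sub>R a + t *\<^sub>R b) *\<^sub>R (y - x))
        \<le> (1 - t) * f (x + a *\<^sub>R (y - x)) + t * f (x + b *\<^sub>R (y - x))"
      using convex_onD[OF assms(1), of t] \<open>0 < t\<close> \<open>t < 1\<close> by simp
  qed simp
  have "((\<lambda>t. f (x + t *\<^sub>R (y - x))) has_real_derivative D \<bullet> (y - x)) (at 0)"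
    by (rule GDERIV_along_line) (simp add: assms(2))
  with conv have "f (x + 1 *\<^sub>R (y - x)) - f (x + 0 *\<^sub>R (y - x)) \<ge> (D \<bullet> (y - x)) * (1 - 0)"
    by (intro convex_on_imp_above_tangent[where A = UNIV]) auto
  then show ?thesis
    by simp
qed

lemma lipschitz_gradient_upper_bound:
  fixes f :: "'a::real_inner \<Rightarrow> real"
  assumes gradient: "\<And>y. GDERIV f y :> g y" and lipschitz: "L-lipschitz_on UNIV g"
  shows "f y \<le> f x + g x \<bullet> (y - x) + L / 2 * (norm (y - x))\<^sup>2"
proof -
  define h where "h = y - x"
  \<comment> \<open>\<open>\<phi>\<close> is \<open>f\<close> along the segment from
    \<open>x\<close> to \<open>y\<close> minus the linear and quadratic terms of the bound. By the
    Lipschitz condition and Cauchy-Schwarz its derivative is nonpositive on [0, 1], and comparing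
    the endpoints gives the claim.\<close>
  define \<phi> where "\<phi> t = f (x + t *\<^sub>R h) - (t * (g x \<bullet> h) + L / 2 * t\<^sup>2 * (norm h)\<^sup>2)" for t
  have "\<phi> 1 \<le> \<phi> 0"
  proof (rule DERIV_nonpos_imp_nonincreasing[where f = \<phi>])
    fix t :: real
    assume "0 \<le> t"
    have line: "((\<lambda>t. f (x + t *\<^sub>R h)) has_real_derivative g (x + t *\<^sub>R h) \<bullet> h) (at t)"
      by (rule GDERIV_along_line[OF gradient])
    have "((\<lambda>t. t * (g x \<bullet> h) + L / 2 * t\<^sup>2 * (norm h)\<^sup>2) has_real_derivative
        g x \<bullet> h + L * t * (norm h)\<^sup>2) (at t)"
      by (rule derivative_eq_intros refl | simp)+
    with line have "(\<phi> has_real_derivative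
        g (x + t *\<^sub>R h) \<bullet> h - (g x \<bullet> h + L * t * (norm h)\<^sup>2)) (at t)"
      unfolding \<phi>_def by (rule DERIV_diff)
    moreover have "norm (g (x + t *\<^sub>R h) - g x) \<le> L * (t * norm h)"
      using lipschitz_onD[OF lipschitz, of "x + t *\<^sub>R h" x] \<open>0 \<le> t\<close> by (simp add: dist_norm)
    then have "(g (x + t *\<^sub>R h) - g x) \<bullet> h \<le> L * (t * norm h) * norm h"
      using norm_cauchy_schwarz[of "g (x + t *\<^sub>R h) - g x" h] mult_right_mono norm_ge_zero
      by (meson order_trans)
    then have "g (x + t *\<^sub>R h) \<bullet> h - (g x \<bullet> h + L * t * (norm h)\<^sup>2) \<le> 0"
      by (simp add: inner_diff_left power2_eq_square mult.assoc)
    ultimately show "\<exists>d. (\<phi> has_real_derivative d) (at t) \<and> d \<le> 0"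
      by blast
  qed simp
  then show ?thesis
    by (simp add: \<phi>_def h_def)
qed

text \<open>For a gradient step the linear term is \<open>- \<beta> * (norm (g x))\<^sup>2\<close>
  and the quadratic term gives half of it back, so a failed test is precisely a sufficient decrease
  of \<open>f\<close>.\<close>

lemma not_backtracking_test_iff:
  assumes "\<beta> > 0"
  shows "\<not> backtracking_test f g x \<beta> \<longleftrightarrow> f (x - \<beta> *\<^sub>R g x) \<le> f x - \<beta> / 2 * (norm (g x))\<^sup>2"
proof -
  have "g x \<bullet> (gradient_step g \<beta> x - x) = - \<beta> * (norm (g x))\<^sup>2"
    by (simp add: gradient_step_def power2_norm_eq_inner)
  moreover have "1 / (2 * \<beta>) * (norm (gradient_step g \<beta> x - x))\<^sup>2 = \<beta> / 2 * (norm (g x))\<^sup>2"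
    using assms by (simp add: gradient_step_def power2_eq_square)
  ultimately have "\<not> backtracking_test f g x \<beta>
      \<longleftrightarrow> f (gradient_step g \<beta> x) \<le> f x - \<beta> / 2 * (norm (g x))\<^sup>2"
    unfolding backtracking_test_def by linarith
  then show ?thesis
    by (simp only: gradient_step_def)
qed

text \<open>Since L / 2 is at most 1 / (2 * \<beta>), the quadratic upper bound implies the bound in
  the test. This lets short steps be treated together with backtracking.\<close>

lemma lipschitz_gradient_not_backtracking_test:
  fixes f :: "'a::real_inner \<Rightarrow> real"
  assumes "\<And>y. GDERIV f y :> g y" and "L-lipschitz_on UNIV g"
    and "L > 0" and "\<beta> > 0" and "\<beta> \<le> 1 / L"
  shows "\<not> backtracking_test f g x \<beta>"
proof -
  have "L / 2 \<le> 1 / (2 * \<beta>)"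
    using assms(3-5) by (simp add: field_simps)
  then have "L / 2 * (norm (gradient_step g \<beta> x - x))\<^sup>2
      \<le> 1 / (2 * \<beta>) * (norm (gradient_step g \<beta> x - x))\<^sup>2"
    by (rule mult_right_mono) simp
  with lipschitz_gradient_upper_bound[OF assms(1,2), of "gradient_step g \<beta> x" x] show ?thesis
    unfolding backtracking_test_def by linarith
qed

text \<open>The point \<open>y\<close> is arbitrary, so the lemma applies to every later iterate and
  not just to the next one.\<close>

lemma gradient_step_closer:
  fixes f :: "'a::real_inner \<Rightarrow> real"
  assumes "convex_on UNIV f" and "GDERIV f x :> g x" and "\<beta> > 0"
    and "f y \<le> f x - \<beta> / 2 * (norm (g x))\<^sup>2"
  shows "norm (y - gradient_step g \<beta> x) \<le> norm (y - x)"
proof -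
  have "g x \<bullet> (y - x) \<le> - (\<beta> / 2 * (norm (g x))\<^sup>2)"
    using convex_on_GDERIV_above_tangent[of f x "g x" y] assms(1,2,4) by linarith
  \<comment> \<open>The factor \<open>2 * \<beta>\<close> is that of the cross term in the expanded
    square; the right-hand side then cancels the term
    \<open>\<beta>\<^sup>2 * (norm (g x))\<^sup>2\<close>.\<close>
  then have "2 * \<beta> * (g x \<bullet> (y - x)) \<le> 2 * \<beta> * - (\<beta> / 2 * (norm (g x))\<^sup>2)"
    using \<open>\<beta> > 0\<close> by (intro mult_left_mono) auto
  moreover have "(norm (y - gradient_step g \<beta> x))\<^sup>2
      = (norm (y - x))\<^sup>2 + 2 * \<beta> * (g x \<bullet> (y - x)) + \<beta>\<^sup>2 * (norm (g x))\<^sup>2"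
    unfolding gradient_step_def power2_norm_eq_inner
    by (simp add: inner_commute algebra_simps power2_eq_square)
  ultimately have "(norm (y - gradient_step g \<beta> x))\<^sup>2 \<le> (norm (y - x))\<^sup>2"
    by (simp add: power2_eq_square)
  then show ?thesis
    by (rule power2_le_imp_le) simp
qed

text \<open>With \<open>k3\<close> fixed, induction moves \<open>k2\<close> upwards from
  \<open>k1\<close>, one index at a time and always below \<open>k3\<close>.\<close>

lemma self_contractedI:
  assumes "\<And>j k. j < k \<Longrightarrow> norm (x k - x (Suc j)) \<le> norm (x k - x j)"
  shows "self_contracted x"
  unfolding self_contracted_def
proof (intro allI impI)
  fix k1 k2 k3 :: nat
  assume "k1 \<le> k2 \<and> k2 \<le> k3"
  then have "k1 \<le> k2" "k2 \<le> k3"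
    by auto
  then show "norm (x k3 - x k2) \<le> norm (x k3 - x k1)"
  proof (induction rule: dec_induct)
    case (step n)
    then show ?case
      using assms[of n k3] by simp
  qed simp
qed

theorem corollary3p9:
  fixes f :: "real ^ 'd \<Rightarrow> real"
    and g :: "real ^ 'd \<Rightarrow> real ^ 'd"
    and L :: real
    and x :: "nat \<Rightarrow> real ^ 'd"
    and s :: "nat \<Rightarrow> real"
  assumes convex: "convex_on UNIV f"
    and gradient: "\<And>y. GDERIV f y :> g y"
    and L_pos: "L > 0"
    and lipschitz: "L-lipschitz_on UNIV g"
    and step_pos: "\<And>k. s k > 0"
    and iteration: "\<And>k. x (Suc k) = x k - s k *\<^sub>R g (x k)"
    and stepsizes: "(\<forall>k. s k \<le> 1 / L) \<or>
      (\<exists>\<alpha> q. \<alpha> > 0 \<and> 0 < q \<and> q < 1 \<and>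
         (\<forall>k. backtracking_stepsize f g \<alpha> q (x k) (s k)))"
  shows "self_contracted x"
proof -
  have descent: "f (x (Suc k)) \<le> f (x k) - s k / 2 * (norm (g (x k)))\<^sup>2" for k
  proof -
    \<comment> \<open>Both stepsize rules meet here: a backtracking stepsize fails the test by
      definition, a short one by the quadratic upper bound.\<close>
    have "\<not> backtracking_test f g (x k) (s k)"
      using stepsizes
    proof
      assume "\<forall>k. s k \<le> 1 / L"
      then show ?thesis
        using lipschitz_gradient_not_backtracking_test[OF gradient lipschitz L_pos step_pos] by blast
    qed (metis backtracking_stepsize_def)
    then show ?thesis
      using step_pos by (simp add: not_backtracking_test_iff iteration)
  qed
  have decreasing: "f (x (Suc k)) \<le> f (x k)" for k
  proof -
    have "0 \<le> s k / 2 * (norm (g (x k)))\<^sup>2"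
      using step_pos[of k] by simp
    with descent[of k] show ?thesis
      by linarith
  qed
  show ?thesis
  proof (rule self_contractedI)
    fix j k :: nat
    assume "j < k"
    \<comment> \<open>Monotonicity is used only from \<open>Suc j\<close> on, which keeps the full
      decrease of step \<open>j\<close> for the next inequality.\<close>
    then have "f (x k) \<le> f (x (Suc j))"
      using lift_Suc_antimono_le[of "\<lambda>k. f (x k)", OF decreasing, of "Suc j" k] by simp
    then have "f (x k) \<le> f (x j) - s j / 2 * (norm (g (x j)))\<^sup>2"
      using descent[of j] by linarith
    then have "norm (x k - gradient_step g (s j) (x j)) \<le> norm (x k - x j)"
      by (rule gradient_step_closer[where f = f and g = g, OF convex gradient step_pos])
    then show "norm (x k - x (Suc j)) \<le> norm (x k - x j)"
      by (simp add: gradient_step_def iteration)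
  qed
qed

end
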